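(* Let $G$ be a topological group which has an open connected component. Then $G$ is connected if and only if $H^1(G,A)=1$ for every discrete abelian topological $G$-module $A$.
   Context: A topological $G$-module $A$ is a topological group on which $G$ acts continuously on the left by group automorphisms, written ${}^g a$; it is discrete (abelian) if the topological group $A$ is discrete (abelian). A continuous derivation is a continuous map $\alpha:G\to A$ with $\alpha(gh)=\alpha(g)\,{}^g\alpha(h)$ for all $g,h\in G$. Two continuous derivations $\alpha,\beta$ are cohomologous if there is $a\in A$ with $\beta(g)=a^{-1}\alpha(g)\,{}^g a$ for all $g\in G$. $H^1(G,A)$ is the set of continuous derivations modulo this equivalence relation, with basepoint the class of $g\mapsto 1$; $H^1(G,A)=1$ means it consists of the basepoint only. *)

theory Defs
  imports "HOL-Analysis.Analysis" "HOL-Algebra.Algebra"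
begin

locale topological_group = group G for G (structure) and T +
  assumes topspace_eq: "topspace T = carrier G"
    and continuous_mult: "continuous_map (prod_topology T T) T (\<lambda>(x, y). x \<otimes> y)"
    and continuous_inv: "continuous_map T T (\<lambda>x. inv x)"

text \<open>
  The product of \<^term>\<open>AutoGroup A\<close> is composition of maps, so a homomorphism
  from \<open>G\<close> into it is a left action by group automorphisms. Its elements are
  extensional, i.e. the maps \<^term>\<open>\<phi> g\<close> are \<open>undefined\<close> outside \<^term>\<open>carrier A\<close>.
\<close>

locale topological_G_module =
  G: topological_group G T + A: topological_group A TA
  for G :: "('g, 'm) monoid_scheme" and T :: "'g topology"
    and A :: "('a, 'n) monoid_scheme" and TA :: "'a topology"
    and \<phi> :: "'g \<Rightarrow> 'a \<Rightarrow> 'a" +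
  assumes action_hom: "\<phi> \<in> hom G (AutoGroup A)"
    and continuous_action: "continuous_map (prod_topology T TA) TA (\<lambda>(g, a). \<phi> g a)"

locale discrete_abelian_G_module =
  topological_G_module G T A TA \<phi> + A: comm_group A
  for G :: "('g, 'm) monoid_scheme" and T :: "'g topology"
    and A :: "('a, 'n) monoid_scheme" and TA :: "'a topology"
    and \<phi> :: "'g \<Rightarrow> 'a \<Rightarrow> 'a" +
  assumes discrete: "TA = discrete_topology (carrier A)"

text \<open>
  Derivations are taken extensional so that they correspond exactly to maps
  \<^term>\<open>carrier G\<close> to \<^term>\<open>carrier A\<close>, irrespective of values outside \<^term>\<open>carrier G\<close>.
\<close>

definition derivations ::
    "('g, 'm) monoid_scheme \<Rightarrow> 'g topology \<Rightarrow> ('a, 'n) monoid_scheme \<Rightarrow> 'a topology \<Rightarrow>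
      ('g \<Rightarrow> 'a \<Rightarrow> 'a) \<Rightarrow> ('g \<Rightarrow> 'a) set" where
  "derivations G T A TA \<phi> =
    {\<alpha> \<in> extensional (carrier G). continuous_map T TA \<alpha> \<and>
      (\<forall>g\<in>carrier G. \<forall>h\<in>carrier G. \<alpha> (g \<otimes>\<^bsub>G\<^esub> h) = \<alpha> g \<otimes>\<^bsub>A\<^esub> \<phi> g (\<alpha> h))}"

definition cohomologous ::
    "('g, 'm) monoid_scheme \<Rightarrow> 'g topology \<Rightarrow> ('a, 'n) monoid_scheme \<Rightarrow> 'a topology \<Rightarrow>
      ('g \<Rightarrow> 'a \<Rightarrow> 'a) \<Rightarrow> (('g \<Rightarrow> 'a) \<times> ('g \<Rightarrow> 'a)) set" where
  "cohomologous G T A TA \<phi> =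
    {(\<alpha>, \<beta>). \<alpha> \<in> derivations G T A TA \<phi> \<and> \<beta> \<in> derivations G T A TA \<phi> \<and>
      (\<exists>a\<in>carrier A. \<forall>g\<in>carrier G. \<beta> g = inv\<^bsub>A\<^esub> a \<otimes>\<^bsub>A\<^esub> \<alpha> g \<otimes>\<^bsub>A\<^esub> \<phi> g a)}"

definition H1 ::
    "('g, 'm) monoid_scheme \<Rightarrow> 'g topology \<Rightarrow> ('a, 'n) monoid_scheme \<Rightarrow> 'a topology \<Rightarrow>
      ('g \<Rightarrow> 'a \<Rightarrow> 'a) \<Rightarrow> ('g \<Rightarrow> 'a) set set" where
  "H1 G T A TA \<phi> = derivations G T A TA \<phi> // cohomologous G T A TA \<phi>"

definition H1_basepoint ::
    "('g, 'm) monoid_scheme \<Rightarrow> 'g topology \<Rightarrow> ('a, 'n) monoid_scheme \<Rightarrow> 'a topology \<Rightarrow>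
      ('g \<Rightarrow> 'a \<Rightarrow> 'a) \<Rightarrow> ('g \<Rightarrow> 'a) set" where
  "H1_basepoint G T A TA \<phi> =
    cohomologous G T A TA \<phi> `` {\<lambda>g\<in>carrier G. \<one>\<^bsub>A\<^esub>}"

context topological_G_module
begin

lemma action_closed: "g \<in> carrier G \<Longrightarrow> a \<in> carrier A \<Longrightarrow> \<phi> g a \<in> carrier A"
  using action_hom by (auto simp: hom_def AutoGroup_def BijGroup_def auto_def Bij_def bij_betw_def)

lemma action_mult:
  "g \<in> carrier G \<Longrightarrow> a \<in> carrier A \<Longrightarrow> b \<in> carrier A \<Longrightarrow> \<phi> g (a \<otimes>\<^bsub>A\<^esub> b) = \<phi> g a \<otimes>\<^bsub>A\<^esub> \<phi> g b"
  using action_hom by (auto simp: hom_def AutoGroup_def BijGroup_def auto_def)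

lemma action_comp:
  assumes "g \<in> carrier G" "h \<in> carrier G" "a \<in> carrier A"
  shows "\<phi> (g \<otimes>\<^bsub>G\<^esub> h) a = \<phi> g (\<phi> h a)"
proof -
  have "\<phi> g \<in> Bij (carrier A)" "\<phi> h \<in> Bij (carrier A)"
    using assms action_hom by (auto simp: hom_def AutoGroup_def BijGroup_def auto_def)
  moreover have "\<phi> (g \<otimes>\<^bsub>G\<^esub> h) = \<phi> g \<otimes>\<^bsub>AutoGroup A\<^esub> \<phi> h"
    using assms action_hom by (simp add: hom_def)
  ultimately show ?thesis
    using assms by (simp add: AutoGroup_def BijGroup_def compose_def)
qed

lemma action_inv:
  assumes "g \<in> carrier G" "a \<in> carrier A"
  shows "\<phi> g (inv\<^bsub>A\<^esub> a) = inv\<^bsub>A\<^esub> \<phi> g a"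
proof -
  have "group_hom A A (\<phi> g)"
    by unfold_locales (use assms in \<open>auto simp: hom_def action_closed action_mult\<close>)
  then show ?thesis
    using assms by (simp add: group_hom.hom_inv)
qed

lemma action_one: "g \<in> carrier G \<Longrightarrow> \<phi> g \<one>\<^bsub>A\<^esub> = \<one>\<^bsub>A\<^esub>"
  by (metis A.l_cancel_one' A.one_closed action_closed action_mult A.l_one)

lemma derivation_closed:
  "\<alpha> \<in> derivations G T A TA \<phi> \<Longrightarrow> g \<in> carrier G \<Longrightarrow> \<alpha> g \<in> carrier A"
  using G.topspace_eq A.topspace_eq by (auto simp: derivations_def continuous_map_def)

lemma trivial_derivation: "(\<lambda>g\<in>carrier G. \<one>\<^bsub>A\<^esub>) \<in> derivations G T A TA \<phi>"
proof -
  have "continuous_map T TA (\<lambda>g. \<one>\<^bsub>A\<^esub>)"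
    by (simp add: A.topspace_eq)
  then have "continuous_map T TA (\<lambda>g\<in>carrier G. \<one>\<^bsub>A\<^esub>)"
    by (rule continuous_map_eq) (simp add: G.topspace_eq)
  then show ?thesis
    by (simp add: derivations_def action_one)
qed

lemma equiv_cohomologous: "equiv (derivations G T A TA \<phi>) (cohomologous G T A TA \<phi>)"
proof (rule equivI)
  let ?Z = "derivations G T A TA \<phi>"
  show "cohomologous G T A TA \<phi> \<subseteq> ?Z \<times> ?Z"
    by (auto simp: cohomologous_def)
  show "refl_on ?Z (cohomologous G T A TA \<phi>)"
    by (intro refl_onI)
      (auto simp: cohomologous_def action_one derivation_closed intro!: bexI[of _ "\<one>\<^bsub>A\<^esub>"])
  show "sym (cohomologous G T A TA \<phi>)"
  proof (rule symI)
    fix \<alpha> \<beta> assume "(\<alpha>, \<beta>) \<in> cohomologous G T A TA \<phi>"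
    then obtain a where a: "a \<in> carrier A" "\<alpha> \<in> ?Z" "\<beta> \<in> ?Z"
      and eq: "\<And>g. g \<in> carrier G \<Longrightarrow> \<beta> g = inv\<^bsub>A\<^esub> a \<otimes>\<^bsub>A\<^esub> \<alpha> g \<otimes>\<^bsub>A\<^esub> \<phi> g a"
      by (auto simp: cohomologous_def)
    have "\<alpha> g = inv\<^bsub>A\<^esub> (inv\<^bsub>A\<^esub> a) \<otimes>\<^bsub>A\<^esub> \<beta> g \<otimes>\<^bsub>A\<^esub> \<phi> g (inv\<^bsub>A\<^esub> a)" if "g \<in> carrier G" for g
    proof -
      have "\<alpha> g \<in> carrier A" "\<phi> g a \<in> carrier A"
        using a that by (auto simp: derivation_closed action_closed)
      moreover from this have "a \<otimes>\<^bsub>A\<^esub> (inv\<^bsub>A\<^esub> a \<otimes>\<^bsub>A\<^esub> \<alpha> g) = \<alpha> g"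
        using a by (simp flip: A.m_assoc)
      ultimately show ?thesis
        using a that by (simp add: eq action_inv A.m_assoc)
    qed
    then show "(\<beta>, \<alpha>) \<in> cohomologous G T A TA \<phi>"
      using a by (auto simp: cohomologous_def intro!: bexI[of _ "inv\<^bsub>A\<^esub> a"])
  qed
  show "trans (cohomologous G T A TA \<phi>)"
  proof (rule transI)
    fix \<alpha> \<beta> \<gamma>
    assume "(\<alpha>, \<beta>) \<in> cohomologous G T A TA \<phi>" "(\<beta>, \<gamma>) \<in> cohomologous G T A TA \<phi>"
    then obtain a b where ab: "a \<in> carrier A" "b \<in> carrier A" "\<alpha> \<in> ?Z" "\<gamma> \<in> ?Z"
      and eq: "\<And>g. g \<in> carrier G \<Longrightarrow> \<beta> g = inv\<^bsub>A\<^esub> a \<otimes>\<^bsub>A\<^esub> \<alpha> g \<otimes>\<^bsub>A\<^esub> \<phi> g a"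
        "\<And>g. g \<in> carrier G \<Longrightarrow> \<gamma> g = inv\<^bsub>A\<^esub> b \<otimes>\<^bsub>A\<^esub> \<beta> g \<otimes>\<^bsub>A\<^esub> \<phi> g b"
      by (auto simp: cohomologous_def)
    have "\<gamma> g = inv\<^bsub>A\<^esub> (a \<otimes>\<^bsub>A\<^esub> b) \<otimes>\<^bsub>A\<^esub> \<alpha> g \<otimes>\<^bsub>A\<^esub> \<phi> g (a \<otimes>\<^bsub>A\<^esub> b)" if "g \<in> carrier G" for g
    proof -
      have "\<alpha> g \<in> carrier A" "\<phi> g a \<in> carrier A" "\<phi> g b \<in> carrier A"
        using ab that by (auto simp: derivation_closed action_closed)
      then show ?thesis
        using ab that by (simp add: eq action_mult A.m_assoc A.inv_mult_group)
    qed
    then show "(\<alpha>, \<gamma>) \<in> cohomologous G T A TA \<phi>"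
      using ab by (auto simp: cohomologous_def intro!: bexI[of _ "a \<otimes>\<^bsub>A\<^esub> b"])
  qed
qed

lemma H1_basepoint_in_H1: "H1_basepoint G T A TA \<phi> \<in> H1 G T A TA \<phi>"
  unfolding H1_def H1_basepoint_def by (rule quotientI) (rule trivial_derivation)

end

end

theory Submission
  imports Defs
begin

text \<open>
  A continuous derivation from a connected group into a discrete module is constant, hence trivial.
  Conversely, if one connected component of \<open>G\<close> is open, then all are. Let \<open>Q\<close> be the set of
  components and consider the augmentation ideal of \<open>\<int>[Q]\<close>, i.e. the finitely supported functions
  \<open>Q \<rightarrow> \<int>\<close> of sum zero, on which \<open>G\<close> acts by translation. Let \<open>\<delta>(g)\<close> denote the point mass at the
  component of \<open>g\<close>. If the derivation \<open>g \<mapsto> \<delta>(g) - \<delta>(1)\<close> is principal, then \<open>\<delta>(1) + c\<close> has finite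
  support and sum zero for some constant \<open>c\<close>. If \<open>Q\<close> is infinite, then \<open>c = 0\<close> and the sum is \<open>1\<close>,
  which is absurd; otherwise \<open>1 + c |Q| = 0\<close>, so \<open>|Q| = 1\<close>. Elements of \<open>\<int>[Q]\<close> are represented by
  functions on \<open>G\<close> that are constant on components.
\<close>

section \<open>Finitely supported sums and maps into discrete spaces\<close>

lemma sum'_eq_sum_superset:
  assumes "finite S" "S \<subseteq> I" "{i \<in> I. f i \<noteq> 0} \<subseteq> S"
  shows "sum' f I = sum f S"
proof -
  have "sum' f S = sum' f I"
    by (rule sum.mono_neutral_left') (use assms in auto)
  then show ?thesis
    using assms by simp
qed

text \<open>Local constancy makes the preimage of every set open. This serves both the translation
  action and the derivation \<open>component_diff\<close>.\<close>

lemma continuous_map_into_discrete_topologyI: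
  assumes "f \<in> topspace M \<rightarrow> S"
    and "\<And>x. x \<in> topspace M \<Longrightarrow> \<exists>U. openin M U \<and> x \<in> U \<and> (\<forall>y\<in>U. f y = f x)"
  shows "continuous_map M (discrete_topology S) f"
  unfolding continuous_map
proof (intro conjI allI impI)
  show "f ` topspace M \<subseteq> topspace (discrete_topology S)"
    using assms(1) by auto
next
  fix V
  show "openin M {x \<in> topspace M. f x \<in> V}"
  proof (subst openin_subopen, rule ballI)
    fix x assume x: "x \<in> {x \<in> topspace M. f x \<in> V}"
    then obtain U where U: "openin M U" "x \<in> U" and const: "\<And>y. y \<in> U \<Longrightarrow> f y = f x"
      using assms(2)[of x] by blast
    have "U \<subseteq> {x \<in> topspace M. f x \<in> V}"
    proof
      fix y assume "y \<in> U"
      then show "y \<in> {x \<in> topspace M. f x \<in> V}"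
        using openin_subset[OF U(1)] const[of y] x by auto
    qed
    with U show "\<exists>U. openin M U \<and> x \<in> U \<and> U \<subseteq> {x \<in> topspace M. f x \<in> V}"
      by blast
  qed
qed

text \<open>The image is a connected subset of a discrete space, hence has at most one
  point.\<close>

lemma connected_space_imp_constant_into_discrete:
  assumes "connected_space M" "continuous_map M (discrete_topology S) f"
    and "x \<in> topspace M" "y \<in> topspace M"
  shows "f x = f y"
proof -
  have "connectedin (discrete_topology S) (f ` topspace M)"
    using assms connectedin_continuous_map_image connectedin_topspace by blast
  then show ?thesis
    using assms by (auto simp: connectedin_discrete_topology)
qed

section \<open>Components of a topological group\<close>

context topological_group
begin

lemma continuous_mult_maps:
  assumes "continuous_map M T f" "continuous_map M T h"
  shows "continuous_map M T (\<lambda>x. f x \<otimes> h x)"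
  using continuous_map_compose[OF continuous_map_pairedI[OF assms] continuous_mult]
  by (simp add: o_def)

lemma connected_component_of_mult_left:
  assumes "g \<in> carrier G" "connected_component_of T x y"
  shows "connected_component_of T (g \<otimes> x) (g \<otimes> y)"
  by (rule connected_component_of_continuous_image[OF _ assms(2)], rule continuous_mult_maps)
    (use assms topspace_eq in auto)

text \<open>Continuity of \<open>h \<mapsto> inv h \<otimes> x\<close> is the reason. It makes the
  translate by \<open>h\<close> of a function constant on components depend only on the component of
  \<open>h\<close>.\<close>

lemma connected_component_of_inv_mult_right:
  assumes "x \<in> carrier G" "connected_component_of T g h"
  shows "connected_component_of T (inv g \<otimes> x) (inv h \<otimes> x)"
  by (rule connected_component_of_continuous_image[OF _ assms(2)],
      intro continuous_mult_maps continuous_inv) (use assms topspace_eq in auto)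

lemma connected_component_of_mult_left_iff:
  assumes "g \<in> carrier G" "x \<in> carrier G" "y \<in> carrier G"
  shows "connected_component_of T (inv g \<otimes> x) y \<longleftrightarrow> connected_component_of T x (g \<otimes> y)"
  using connected_component_of_mult_left[of g "inv g \<otimes> x" y]
    connected_component_of_mult_left[of "inv g" x "g \<otimes> y"] assms
  by (auto simp flip: m_assoc)

lemma openin_all_components:
  assumes "C \<in> connected_components_of T" "openin T C" "g \<in> carrier G"
  shows "openin T (connected_component_of_set T g)"
proof -
  obtain c where c: "c \<in> carrier G" "C = connected_component_of_set T c"
    using assms(1) topspace_eq by (auto simp: connected_components_of_def)
  \<comment> \<open>This left translation carries \<open>g\<close> to \<open>c\<close>, so the
    component of \<open>g\<close> is the preimage of \<open>C\<close>, and continuity transports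
    openness.\<close>
  let ?h = "\<lambda>x. c \<otimes> (inv g \<otimes> x)"
  have cont: "continuous_map T T ?h"
    by (intro continuous_mult_maps) (use assms c topspace_eq in auto)
  have "connected_component_of T c (?h x) \<longleftrightarrow> connected_component_of T g x" if "x \<in> carrier G" for x
  proof -
    have "connected_component_of T c (?h x) \<longleftrightarrow> connected_component_of T (?h x) c"
      by (rule connected_component_of_sym)
    also have "\<dots> \<longleftrightarrow> connected_component_of T (inv g \<otimes> x) \<one>"
      using connected_component_of_mult_left_iff[of c "c \<otimes> (inv g \<otimes> x)" \<one>] c assms that
      by (simp flip: m_assoc)
    also have "\<dots> \<longleftrightarrow> connected_component_of T g x"
      using connected_component_of_mult_left_iff[of g x \<one>] assms that
      by (simp add: connected_component_of_sym)
    finally show ?thesis .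
  qed
  then have "connected_component_of_set T g = {x \<in> topspace T. ?h x \<in> C}"
    using c connected_component_of_subset_topspace[of T g] topspace_eq by auto
  then show ?thesis
    using openin_continuous_map_preimage[OF cont assms(2)] by simp
qed

lemma connected_component_of_rep:
  assumes "C \<in> connected_components_of T"
  shows "(SOME x. x \<in> C) \<in> carrier G" "connected_component_of_set T (SOME x. x \<in> C) = C"
proof -
  obtain c where c: "c \<in> topspace T" "C = connected_component_of_set T c"
    using assms by (auto simp: connected_components_of_def)
  then have "c \<in> C"
    by (simp add: connected_component_of_refl)
  then have "(SOME x. x \<in> C) \<in> C"
    by (rule someI)
  then have *: "connected_component_of T c (SOME x. x \<in> C)"
    using c by simp
  then have "connected_component_of T c = connected_component_of T (SOME x. x \<in> C)"
    by (rule connected_component_of_equiv[THEN iffD1, THEN conjunct2, THEN conjunct2])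
  then have "connected_component_of_set T (SOME x. x \<in> C) = connected_component_of_set T c"
    by (simp only:)
  then show "connected_component_of_set T (SOME x. x \<in> C) = C"
    by (simp only: c(2)[symmetric])
  show "(SOME x. x \<in> C) \<in> carrier G"
    using * connected_component_in_topspace topspace_eq by fastforce
qed

text \<open>Components that share a point coincide. This evaluates point masses at the
  representatives used by \<open>component_value\<close>.\<close>

lemma connected_component_of_rep_iff:
  assumes "C \<in> connected_components_of T" "h \<in> carrier G"
  shows "connected_component_of T h (SOME x. x \<in> C) \<longleftrightarrow> C = connected_component_of_set T h"
proof -
  let ?r = "SOME x. x \<in> C"
  note r = connected_component_of_rep[OF assms(1)]
  have "connected_component_of T h ?r \<longleftrightarrow> connected_component_of T h = connected_component_of T ?r"
    using r(1) assms(2) topspace_eq by (subst connected_component_of_equiv) simp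
  also have "\<dots> \<longleftrightarrow> connected_component_of_set T h = connected_component_of_set T ?r"
    by (metis Collect_inj)
  finally show ?thesis
    using r(2) by auto
qed

section \<open>The augmentation ideal\<close>

text \<open>Passes from functions on \<open>G\<close> to functions on the set of components; for
  functions constant on components the choice of representative is immaterial.\<close>

definition component_value :: "('a \<Rightarrow> int) \<Rightarrow> 'a set \<Rightarrow> int" where
  "component_value a C = a (SOME x. x \<in> C)"

text \<open>Vanishing off \<open>carrier G\<close> makes an element determined by its values on the
  group. Finiteness is a separate condition because \<open>sum'\<close> defaults to 0 on infinite
  support. Functions on points, rather than on components, keep the module within a type over which
  the final theorem quantifies.\<close>

definition augmentation_carrier :: "('a \<Rightarrow> int) set" where
  "augmentation_carrier = {a. (\<forall>x. x \<notin> carrier G \<longrightarrow> a x = 0) \<and>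
     (\<forall>x y. connected_component_of T x y \<longrightarrow> a x = a y) \<and>
     finite {C \<in> connected_components_of T. component_value a C \<noteq> 0} \<and>
     sum' (component_value a) (connected_components_of T) = 0}"

definition augmentation_ideal :: "('a \<Rightarrow> int) monoid" where
  "augmentation_ideal =
    \<lparr>carrier = augmentation_carrier, mult = (\<lambda>a b x. a x + b x), one = (\<lambda>x. 0)\<rparr>"

text \<open>The inverse makes this a left action; the restriction to
  \<open>augmentation_carrier\<close> yields the extensional maps that \<open>AutoGroup\<close>
  demands.\<close>

definition translate :: "'a \<Rightarrow> ('a \<Rightarrow> int) \<Rightarrow> 'a \<Rightarrow> int" where
  "translate g = (\<lambda>a\<in>augmentation_carrier. \<lambda>x. if x \<in> carrier G then a (inv g \<otimes> x) else 0)"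

text \<open>This is \<open>\<delta>(g) - \<delta>(1)\<close>, each point mass being the indicator of
  a component.\<close>

definition component_diff :: "'a \<Rightarrow> 'a \<Rightarrow> int" where
  "component_diff g = (\<lambda>x. of_bool (connected_component_of T g x) - of_bool (connected_component_of T \<one> x))"

section \<open>Group structure of the augmentation ideal\<close>

lemma augmentation_const:
  "a \<in> augmentation_carrier \<Longrightarrow> connected_component_of T x y \<Longrightarrow> a x = a y"
  by (simp add: augmentation_carrier_def)

lemma augmentation_zero: "(\<lambda>x. 0) \<in> augmentation_carrier"
  by (auto simp: augmentation_carrier_def component_value_def sum.G_def)

lemma augmentation_add:
  assumes "a \<in> augmentation_carrier" "b \<in> augmentation_carrier"
  shows "(\<lambda>x. a x + b x) \<in> augmentation_carrier"
proof -
  have eq: "component_value (\<lambda>x. a x + b x) = (\<lambda>C. component_value a C + component_value b C)"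
    by (simp add: component_value_def fun_eq_iff)
  have "finite {C \<in> connected_components_of T. component_value (\<lambda>x. a x + b x) C \<noteq> 0}"
    unfolding eq by (rule sum.finite_Collect_op) (use assms in \<open>auto simp: augmentation_carrier_def\<close>)
  moreover have "sum' (component_value (\<lambda>x. a x + b x)) (connected_components_of T) = 0"
    unfolding eq using assms by (subst sum.distrib') (auto simp: augmentation_carrier_def)
  ultimately show ?thesis
    using assms unfolding augmentation_carrier_def by fastforce
qed

lemma augmentation_uminus:
  assumes "a \<in> augmentation_carrier"
  shows "(\<lambda>x. - a x) \<in> augmentation_carrier"
proof -
  have eq: "component_value (\<lambda>x. - a x) = (\<lambda>C. - component_value a C)"
    by (simp add: component_value_def fun_eq_iff)
  have "sum' (component_value (\<lambda>x. - a x)) (connected_components_of T) = 0"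
    using assms by (auto simp: eq augmentation_carrier_def sum.G_def sum_negf)
  then show ?thesis
    using assms by (simp add: augmentation_carrier_def eq)
qed

lemma comm_group_augmentation_ideal: "comm_group augmentation_ideal"
proof (rule comm_groupI)
  fix a assume "a \<in> carrier augmentation_ideal"
  then show "\<exists>b\<in>carrier augmentation_ideal. b \<otimes>\<^bsub>augmentation_ideal\<^esub> a = \<one>\<^bsub>augmentation_ideal\<^esub>"
    by (intro bexI[of _ "\<lambda>x. - a x"]) (auto simp: augmentation_ideal_def augmentation_uminus)
qed (auto simp: augmentation_ideal_def augmentation_zero augmentation_add algebra_simps)

section \<open>The translation action\<close>

lemma translate_closed:
  assumes g: "g \<in> carrier G" and a: "a \<in> augmentation_carrier"
  shows "translate g a \<in> augmentation_carrier"
proof -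
  let ?K = "connected_components_of T"
  \<comment> \<open>For \<open>h\<close> in the group, \<open>?s h\<close> is the permutation of the
    components induced by left multiplication by \<open>h\<close>. The values of
    \<open>translate g a\<close> are those of \<open>a\<close> permuted by
    \<open>?s (inv g)\<close>, so finite support and zero sum carry over.\<close>
  let ?s = "\<lambda>h C. connected_component_of_set T (h \<otimes> (SOME x. x \<in> C))"
  have in_K: "?s h C \<in> ?K" if "h \<in> carrier G" "C \<in> ?K" for h C
    using that connected_component_of_rep(1)[of C] topspace_eq
    by (auto simp: connected_components_of_def)
  have inverse: "?s h (?s k C) = C" if "h \<in> carrier G" "k = inv h" "C \<in> ?K" for h k C
  proof -
    let ?r = "SOME x. x \<in> C" and ?t = "SOME x. x \<in> ?s k C"
    have k: "k \<in> carrier G" using that by simp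
    note r = connected_component_of_rep[OF that(3)]
    \<comment> \<open>The representative of \<open>?s k C\<close> need not be
      \<open>k \<otimes> ?r\<close>; it only lies in the same component.\<close>
    have "connected_component_of T (k \<otimes> ?r) ?t"
      using connected_component_of_rep_iff[OF in_K[OF k that(3)]] r(1) k by simp
    then have "connected_component_of T (h \<otimes> (k \<otimes> ?r)) (h \<otimes> ?t)"
      by (rule connected_component_of_mult_left[OF that(1)])
    moreover have "h \<otimes> (k \<otimes> ?r) = ?r"
      using that r(1) by (simp flip: m_assoc)
    ultimately have "connected_component_of T ?r = connected_component_of T (h \<otimes> ?t)"
      using connected_component_of_equiv[of T ?r] by simp
    then show ?thesis
      using r(2) by simp
  qed
  have bij: "bij_betw (?s (inv g)) ?K ?K"
  proof (rule bij_betw_byWitness[where f' = "?s g"])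
    show "\<forall>C\<in>?K. ?s g (?s (inv g) C) = C" "\<forall>C\<in>?K. ?s (inv g) (?s g C) = C"
      using g inverse[of g "inv g"] inverse[of "inv g" g] by (simp_all add: inv_inv)
    show "?s (inv g) ` ?K \<subseteq> ?K" "?s g ` ?K \<subseteq> ?K"
      using g in_K by blast+
  qed
  have val: "component_value (translate g a) C = component_value a (?s (inv g) C)" if "C \<in> ?K" for C
  proof -
    have i: "inv g \<in> carrier G" using g by simp
    note r = connected_component_of_rep[OF that]
    have "connected_component_of T (inv g \<otimes> (SOME x. x \<in> C)) (SOME x. x \<in> ?s (inv g) C)"
      using connected_component_of_rep_iff[OF in_K[OF i that]] r(1) i by simp
    then show ?thesis
      using a r(1) by (simp add: component_value_def translate_def augmentation_const)
  qed
  let ?v = "component_value a" and ?w = "component_value (translate g a)"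
  have supp: "bij_betw (?s (inv g)) {C \<in> ?K. ?w C \<noteq> 0} {C \<in> ?K. ?v C \<noteq> 0}"
    by (rule bij_betw_Collect[OF bij]) (simp add: val)
  have fin: "finite {C \<in> ?K. ?v C \<noteq> 0}" "sum' ?v ?K = 0"
    using a by (auto simp: augmentation_carrier_def)
  have "sum ?w {C \<in> ?K. ?w C \<noteq> 0} = (\<Sum>C | C \<in> ?K \<and> ?w C \<noteq> 0. ?v (?s (inv g) C))"
    by (rule sum.cong) (auto simp: val)
  also have "\<dots> = sum ?v {C \<in> ?K. ?v C \<noteq> 0}"
    by (rule sum.reindex_bij_betw[OF supp])
  finally have "sum' ?w ?K = 0"
    using fin bij_betw_finite[OF supp] by (simp add: sum.G_def)
  moreover have "finite {C \<in> ?K. ?w C \<noteq> 0}"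
    using fin bij_betw_finite[OF supp] by simp
  moreover have "translate g a x = translate g a y" if "connected_component_of T x y" for x y
    using connected_component_of_mult_left[OF inv_closed[OF g] that] a
      connected_component_in_topspace[OF that] topspace_eq
    by (simp add: translate_def augmentation_const)
  ultimately show ?thesis
    using a unfolding augmentation_carrier_def by (auto simp: translate_def augmentation_carrier_def)
qed

lemma translate_mult:
  assumes "g \<in> carrier G" "h \<in> carrier G" "a \<in> augmentation_carrier"
  shows "translate (g \<otimes> h) a = translate g (translate h a)"
  using assms translate_closed[of h a]
  by (auto simp: translate_def fun_eq_iff inv_mult_group m_assoc)

lemma translate_one:
  assumes "a \<in> augmentation_carrier"
  shows "translate \<one> a = a"
  using assms by (auto simp: translate_def fun_eq_iff augmentation_carrier_def)

lemma translate_hom: "translate \<in> hom G (AutoGroup augmentation_ideal)"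
proof -
  have bij: "translate g \<in> Bij augmentation_carrier" if g: "g \<in> carrier G" for g
  proof -
    have "bij_betw (translate g) augmentation_carrier augmentation_carrier"
      by (rule bij_betw_byWitness[where f' = "translate (inv g)"])
        (use g in \<open>auto simp: translate_closed translate_one simp flip: translate_mult\<close>)
    then show ?thesis
      by (simp add: Bij_def translate_def)
  qed
  have auto: "translate g \<in> auto augmentation_ideal" if g: "g \<in> carrier G" for g
    using bij[OF g] translate_closed[OF g]
    by (auto simp: auto_def hom_def augmentation_ideal_def augmentation_add translate_def fun_eq_iff)
  have "translate (g \<otimes> h) = compose augmentation_carrier (translate g) (translate h)"
    if "g \<in> carrier G" "h \<in> carrier G" for g h
  proof
    \<comment> \<open>Outside \<open>augmentation_carrier\<close> both sides are
      \<open>undefined\<close>.\<close>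
    fix a show "translate (g \<otimes> h) a = compose augmentation_carrier (translate g) (translate h) a"
      using that by (cases "a \<in> augmentation_carrier") (simp_all add: compose_def translate_mult, simp add: translate_def)
  qed
  then show ?thesis
    using auto bij
    by (auto simp: hom_def AutoGroup_def BijGroup_def augmentation_ideal_def)
qed

section \<open>The derivation given by differences of point masses\<close>

lemma component_diff_closed:
  assumes g: "g \<in> carrier G"
  shows "component_diff g \<in> augmentation_carrier"
proof -
  let ?K = "connected_components_of T"
  let ?g = "connected_component_of_set T g" and ?e = "connected_component_of_set T \<one>"
  have K: "?g \<in> ?K" "?e \<in> ?K"
    using g topspace_eq by (auto simp: connected_components_of_def)
  have val: "component_value (component_diff g) C = of_bool (C = ?g) - of_bool (C = ?e)"
    if "C \<in> ?K" for C
    using g that by (simp add: component_value_def component_diff_def connected_component_of_rep_iff)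
  have supp: "{C \<in> ?K. component_value (component_diff g) C \<noteq> 0} \<subseteq> {?g, ?e}"
    using val by (auto split: if_splits)
  \<comment> \<open>If the two components agree, the support is empty and the set
    \<open>{?g, ?e}\<close> contributes the single term 1 - 1; otherwise its terms are 1 and
    -1.\<close>
  have "sum' (component_value (component_diff g)) ?K = sum (component_value (component_diff g)) {?g, ?e}"
    by (rule sum'_eq_sum_superset) (use supp K in auto)
  also have "\<dots> = (\<Sum>C\<in>{?g, ?e}. of_bool (C = ?g) - of_bool (C = ?e))"
    by (rule sum.cong) (use K val in auto)
  also have "\<dots> = 0"
    by (cases "?g = ?e") auto
  finally have "sum' (component_value (component_diff g)) ?K = 0" .
  moreover have "finite {C \<in> ?K. component_value (component_diff g) C \<noteq> 0}"
    using supp by (rule finite_subset) simp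
  moreover have "component_diff g x = 0" if "x \<notin> carrier G" for x
    using that topspace_eq connected_component_in_topspace[of T _ x] by (auto simp: component_diff_def)
  moreover have "component_diff g x = component_diff g y" if "connected_component_of T x y" for x y
  proof -
    have "connected_component_of T h x \<longleftrightarrow> connected_component_of T h y" for h
      using that connected_component_of_trans[of T h x y] connected_component_of_trans[of T h y x]
        connected_component_of_sym[of T x y] by blast
    then show ?thesis
      by (simp add: component_diff_def)
  qed
  ultimately show ?thesis
    by (auto simp: augmentation_carrier_def)
qed

text \<open>The derivation identity in additive form: \<open>\<delta>(gh) - \<delta>(1)\<close>
  splits as \<open>\<delta>(g) - \<delta>(1)\<close> plus \<open>\<delta>(gh) - \<delta>(g)\<close>,
  and the latter is the translate by \<open>g\<close> of
  \<open>\<delta>(h) - \<delta>(1)\<close>.\<close>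

lemma component_diff_mult:
  assumes "g \<in> carrier G" "h \<in> carrier G"
  shows "component_diff (g \<otimes> h) = (\<lambda>x. component_diff g x + translate g (component_diff h) x)"
proof
  fix x
  show "component_diff (g \<otimes> h) x = component_diff g x + translate g (component_diff h) x"
  proof (cases "x \<in> carrier G")
    case True
    have "connected_component_of T k (inv g \<otimes> x) \<longleftrightarrow> connected_component_of T (g \<otimes> k) x"
      if "k \<in> carrier G" for k
      using connected_component_of_mult_left_iff[OF assms(1) True that]
      by (simp add: connected_component_of_sym)
    then show ?thesis
      using True assms component_diff_closed[OF assms(2)]
      by (simp add: translate_def component_diff_def)
  next
    case False
    then show ?thesis
      using component_diff_closed[of g] component_diff_closed[of "g \<otimes> h"] component_diff_closed[OF assms(2)] assms
      by (simp add: translate_def augmentation_carrier_def)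
  qed
qed

lemma component_diff_principal_imp_connected:
  assumes a: "a \<in> augmentation_carrier"
    and eq: "\<And>g. g \<in> carrier G \<Longrightarrow> component_diff g = (\<lambda>x. translate g a x - a x)"
  shows "connected_space T"
proof (rule ccontr)
  assume "\<not> connected_space T"
  let ?K = "connected_components_of T"
  let ?e = "connected_component_of_set T \<one>"
  have e: "?e \<in> ?K"
    using topspace_eq by (auto simp: connected_components_of_def)
  have "\<exists>D\<in>?K. D \<noteq> ?e"
  proof (rule ccontr)
    assume "\<not> ?thesis"
    then have "?K \<subseteq> {?e}" by auto
    then show False
      using \<open>\<not> connected_space T\<close> connected_space_iff_components_subset_singleton by blast
  qed
  then obtain D where D: "D \<in> ?K" "D \<noteq> ?e"
    by blast
  \<comment> \<open>Evaluating \<open>eq\<close> at \<open>x = g\<close> gives \<open>1 - of_bool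
    (connected_component_of T \<one> g) = a \<one> - a g\<close>, which determines \<open>a\<close>
    on the group with this constant.\<close>
  define c where "c = a \<one> - 1"
  have ag: "a g = c + of_bool (connected_component_of T \<one> g)" if "g \<in> carrier G" for g
  proof -
    have "component_diff g g = translate g a g - a g"
      using eq[OF that] by (rule fun_cong)
    moreover have "connected_component_of T g g"
      using that topspace_eq by (simp add: connected_component_of_refl)
    ultimately show ?thesis
      using that a by (simp add: component_diff_def translate_def c_def)
  qed
  have val: "component_value a C = c + of_bool (C = ?e)" if "C \<in> ?K" for C
    using ag[OF connected_component_of_rep(1)[OF that]] that
    by (simp add: component_value_def connected_component_of_rep_iff)
  have fin: "finite {C \<in> ?K. component_value a C \<noteq> 0}" "sum' (component_value a) ?K = 0"
    using a by (auto simp: augmentation_carrier_def)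
  show False
  proof (cases "c = 0")
    case True
    have "sum' (component_value a) ?K = sum (component_value a) {?e}"
      by (rule sum'_eq_sum_superset) (use e val True in auto)
    then show False
      using fin(2) val[OF e] True by simp
  next
    case False
    \<comment> \<open>The value at \<open>?e\<close> is \<open>c + 1\<close>, which may vanish,
      hence the \<open>insert\<close>.\<close>
    have "?K \<subseteq> insert ?e {C \<in> ?K. component_value a C \<noteq> 0}"
    proof
      fix C assume "C \<in> ?K"
      then show "C \<in> insert ?e {C \<in> ?K. component_value a C \<noteq> 0}"
        by (cases "C = ?e") (simp_all add: val False)
    qed
    then have K: "finite ?K"
      using fin(1) by (meson finite_insert finite_subset)
    then have "sum' (component_value a) ?K = (\<Sum>C\<in>?K. c + of_bool (C = ?e))"
      using val by simp
    also have "\<dots> = int (card ?K) * c + 1"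
      using K e by (simp add: sum.distrib)
    \<comment> \<open>Integer coefficients are decisive: over the rationals,
      \<open>c = -1 / card ?K\<close> would solve this for any finite number of components.\<close>
    finally have "int (card ?K) * (- c) = 1"
      using fin(2) by simp
    then have "int (card ?K) dvd 1"
      by (metis dvd_triv_left)
    then have "card ?K = 1"
      by simp
    then show False
      using D e by (metis card_1_singletonE singletonD)
  qed
qed

text \<open>The action is constant on the product of the component of \<open>g\<close> with
  \<open>{a}\<close>, and this product is open because components are.\<close>

lemma discrete_abelian_augmentation_module:
  assumes "\<And>g. g \<in> carrier G \<Longrightarrow> openin T (connected_component_of_set T g)"
  shows "discrete_abelian_G_module G T augmentation_ideal (discrete_topology augmentation_carrier) translate"
proof -
  interpret A: comm_group augmentation_ideal
    by (rule comm_group_augmentation_ideal)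
  have car: "carrier augmentation_ideal = augmentation_carrier"
    by (simp add: augmentation_ideal_def)
  let ?D = "discrete_topology augmentation_carrier"
  \<comment> \<open>Discreteness of the product yields continuity of the addition.\<close>
  have prod: "prod_topology ?D ?D = discrete_topology (augmentation_carrier \<times> augmentation_carrier)"
  proof (rule sym, subst discrete_topology_unique, intro conjI ballI)
    fix p assume "p \<in> augmentation_carrier \<times> augmentation_carrier"
    then have "openin (prod_topology ?D ?D) ({fst p} \<times> {snd p})"
      by (subst openin_prod_Times_iff) auto
    then show "openin (prod_topology ?D ?D) {p}"
      by simp
  qed simp
  have "continuous_map (prod_topology T ?D) ?D (\<lambda>(g, a). translate g a)"
  proof (rule continuous_map_into_discrete_topologyI)
    fix p assume "p \<in> topspace (prod_topology T ?D)"
    then obtain g a where p: "p = (g, a)" "g \<in> carrier G" "a \<in> augmentation_carrier"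
      using topspace_eq by auto
    have const: "translate h a = translate g a" if "connected_component_of T g h" for h
    proof -
      have h: "h \<in> carrier G"
        using that connected_component_in_topspace topspace_eq by fastforce
      have "a (inv h \<otimes> x) = a (inv g \<otimes> x)" if "x \<in> carrier G" for x
        using augmentation_const[OF p(3) connected_component_of_inv_mult_right[OF that \<open>connected_component_of T g h\<close>]]
        by (rule sym)
      then show ?thesis
        using p by (auto simp: translate_def fun_eq_iff)
    qed
    show "\<exists>U. openin (prod_topology T ?D) U \<and> p \<in> U \<and>
        (\<forall>q\<in>U. (case q of (g, a) \<Rightarrow> translate g a) = (case p of (g, a) \<Rightarrow> translate g a))"
    proof (intro exI conjI ballI)
      show "openin (prod_topology T ?D) (connected_component_of_set T g \<times> {a})"
        using p assms by (subst openin_prod_Times_iff) simp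
      show "p \<in> connected_component_of_set T g \<times> {a}"
        using p topspace_eq by (simp add: connected_component_of_refl)
    next
      fix q assume "q \<in> connected_component_of_set T g \<times> {a}"
      then obtain h where "q = (h, a)" "connected_component_of T g h"
        by blast
      then show "(case q of (g, a) \<Rightarrow> translate g a) = (case p of (g, a) \<Rightarrow> translate g a)"
        using p(1) const by simp
    qed
  qed (use topspace_eq in \<open>auto simp: translate_closed\<close>)
  then show ?thesis
    using A.m_closed A.inv_closed by unfold_locales (auto simp: car prod translate_hom)
qed

end

section \<open>Triviality of the first cohomology\<close>

context topological_G_module
begin

lemma H1_trivialI:
  assumes "derivations G T A TA \<phi> = {\<lambda>g\<in>carrier G. \<one>\<^bsub>A\<^esub>}"
  shows "H1 G T A TA \<phi> = {H1_basepoint G T A TA \<phi>}"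
  by (simp add: H1_def H1_basepoint_def assms quotient_def)

text \<open>Equality with the base class makes \<alpha> cohomologous to the trivial derivation,
  whose value \<one> drops out of the formula.\<close>

lemma H1_trivialD:
  assumes "H1 G T A TA \<phi> = {H1_basepoint G T A TA \<phi>}" "\<alpha> \<in> derivations G T A TA \<phi>"
  obtains a where "a \<in> carrier A"
    "\<And>g. g \<in> carrier G \<Longrightarrow> \<alpha> g = inv\<^bsub>A\<^esub> a \<otimes>\<^bsub>A\<^esub> \<phi> g a"
proof -
  have "cohomologous G T A TA \<phi> `` {\<alpha>} \<in> H1 G T A TA \<phi>"
    using assms(2) by (simp add: H1_def quotientI)
  then have "cohomologous G T A TA \<phi> `` {\<alpha>} = cohomologous G T A TA \<phi> `` {\<lambda>g\<in>carrier G. \<one>\<^bsub>A\<^esub>}"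
    using assms(1) by (simp add: H1_basepoint_def)
  then have "((\<lambda>g\<in>carrier G. \<one>\<^bsub>A\<^esub>), \<alpha>) \<in> cohomologous G T A TA \<phi>"
    using equiv_class_self[OF equiv_cohomologous assms(2)] by blast
  then show thesis
    using that by (auto simp: cohomologous_def)
qed

end

lemma (in discrete_abelian_G_module) H1_trivial_if_connected:
  assumes "connected_space T"
  shows "H1 G T A TA \<phi> = {H1_basepoint G T A TA \<phi>}"
proof (rule H1_trivialI, rule equalityI)
  show "{\<lambda>g\<in>carrier G. \<one>\<^bsub>A\<^esub>} \<subseteq> derivations G T A TA \<phi>"
    using trivial_derivation by simp
  show "derivations G T A TA \<phi> \<subseteq> {\<lambda>g\<in>carrier G. \<one>\<^bsub>A\<^esub>}"
  proof
    fix \<alpha> assume \<alpha>: "\<alpha> \<in> derivations G T A TA \<phi>"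
    have const: "\<alpha> g = \<alpha> \<one>\<^bsub>G\<^esub>" if "g \<in> carrier G" for g
      by (rule connected_space_imp_constant_into_discrete[OF assms, of "carrier A"])
        (use \<alpha> that discrete G.topspace_eq in \<open>auto simp: derivations_def\<close>)
    let ?c = "\<alpha> \<one>\<^bsub>G\<^esub>"
    have c: "?c \<in> carrier A"
      using derivation_closed[OF \<alpha>] by simp
    \<comment> \<open>The derivation identity at the pair of identities, after cancelling
      \<open>?c\<close>, says that \<open>\<phi> \<one>\<close> sends \<open>?c\<close> to \<one>;
      injectivity then forces \<open>?c\<close> to be trivial.\<close>
    have "\<alpha> (\<one>\<^bsub>G\<^esub> \<otimes>\<^bsub>G\<^esub> \<one>\<^bsub>G\<^esub>) = ?c \<otimes>\<^bsub>A\<^esub> \<phi> \<one>\<^bsub>G\<^esub> ?c"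
      using \<alpha> unfolding derivations_def by blast
    then have "\<phi> \<one>\<^bsub>G\<^esub> ?c = \<phi> \<one>\<^bsub>G\<^esub> \<one>\<^bsub>A\<^esub>"
      using c by (simp add: action_one action_closed A.r_cancel_one' A.l_cancel_one)
    moreover have "inj_on (\<phi> \<one>\<^bsub>G\<^esub>) (carrier A)"
      using action_hom
      by (auto simp: hom_def AutoGroup_def auto_def Bij_def bij_betw_def Pi_def)
    ultimately have one: "?c = \<one>\<^bsub>A\<^esub>"
      using c by (simp add: inj_on_eq_iff)
    have "\<alpha> = (\<lambda>g\<in>carrier G. \<one>\<^bsub>A\<^esub>)"
    proof (intro extensionalityI)
      show "\<alpha> \<in> extensional (carrier G)"
        using \<alpha> unfolding derivations_def by blast
      show "\<alpha> g = (\<lambda>g\<in>carrier G. \<one>\<^bsub>A\<^esub>) g" if "g \<in> carrier G" for g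
        using const[OF that] one that by simp
    qed (rule restrict_extensional)
    then show "\<alpha> \<in> {\<lambda>g\<in>carrier G. \<one>\<^bsub>A\<^esub>}"
      by simp
  qed
qed

text \<open>This one module detects disconnectedness: trivial cohomology makes
  \<open>component_diff\<close> principal.\<close>

lemma (in topological_group) connected_if_H1_trivial:
  assumes opn: "\<And>g. g \<in> carrier G \<Longrightarrow> openin T (connected_component_of_set T g)"
    and H1: "H1 G T augmentation_ideal (discrete_topology augmentation_carrier) translate =
      {H1_basepoint G T augmentation_ideal (discrete_topology augmentation_carrier) translate}"
  shows "connected_space T"
proof -
  let ?D = "discrete_topology augmentation_carrier"
  interpret M: discrete_abelian_G_module G T augmentation_ideal ?D translate
    by (rule discrete_abelian_augmentation_module[OF opn])
  \<comment> \<open>Restricted because \<open>derivations\<close> contains only extensional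
    maps.\<close>
  let ?\<alpha> = "\<lambda>g\<in>carrier G. component_diff g"
  have "continuous_map T ?D ?\<alpha>"
  proof (rule continuous_map_into_discrete_topologyI)
    fix g assume g: "g \<in> topspace T"
    have const: "?\<alpha> h = ?\<alpha> g" if "connected_component_of T g h" for h
    proof -
      have "connected_component_of T h = connected_component_of T g"
        using that by (auto simp: connected_component_of_equiv)
      then show ?thesis
        using connected_component_in_topspace[OF that] topspace_eq
        by (simp add: component_diff_def)
    qed
    show "\<exists>U. openin T U \<and> g \<in> U \<and> (\<forall>h\<in>U. ?\<alpha> h = ?\<alpha> g)"
    proof (intro exI conjI ballI)
      show "openin T (connected_component_of_set T g)" "g \<in> connected_component_of_set T g"
        using g opn topspace_eq by (simp_all add: connected_component_of_refl)
      fix h assume "h \<in> connected_component_of_set T g"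
      then have "connected_component_of T g h"
        by (rule CollectD)
      then show "?\<alpha> h = ?\<alpha> g"
        by (rule const)
    qed
  qed (use topspace_eq in \<open>auto simp: component_diff_closed\<close>)
  then have "?\<alpha> \<in> derivations G T augmentation_ideal ?D translate"
    by (simp add: derivations_def component_diff_mult) (simp add: augmentation_ideal_def)
  from M.H1_trivialD[OF H1 this] obtain a where a: "a \<in> carrier augmentation_ideal"
    and eq: "\<And>g. g \<in> carrier G \<Longrightarrow>
      ?\<alpha> g = inv\<^bsub>augmentation_ideal\<^esub> a \<otimes>\<^bsub>augmentation_ideal\<^esub> translate g a"
    by blast
  \<comment> \<open>With inversion read as negation, \<open>eq\<close> becomes the additive
    condition \<open>component_diff g = translate g a - a\<close>.\<close>
  have inv_a: "inv\<^bsub>augmentation_ideal\<^esub> a = (\<lambda>x. - a x)"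
    by (rule M.A.inv_equality)
      (use a in \<open>auto simp: augmentation_ideal_def augmentation_uminus\<close>)
  show ?thesis
  proof (rule component_diff_principal_imp_connected)
    show "a \<in> augmentation_carrier"
      using a by (simp add: augmentation_ideal_def)
    fix g assume "g \<in> carrier G"
    then show "component_diff g = (\<lambda>x. translate g a x - a x)"
      using eq[of g] by (simp add: inv_a) (simp add: augmentation_ideal_def fun_eq_iff)
  qed
qed

text \<open>A formula cannot quantify over types, so the equivalence uses coefficients of type
  \<open>'g \<Rightarrow> int\<close>, where the augmentation ideal lives. The second conjunct
  extends the forward implication to coefficients of any type.\<close>

theorem theorem5p7:
  fixes G :: "('g, 'm) monoid_scheme" and T :: "'g topology"
  assumes "topological_group G T"
    and "\<exists>C \<in> connected_components_of T. openin T C"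
  shows "(connected_space T \<longleftrightarrow>
            (\<forall>(A :: ('g \<Rightarrow> int) monoid) TA \<phi>. discrete_abelian_G_module G T A TA \<phi> \<longrightarrow>
               H1 G T A TA \<phi> = {H1_basepoint G T A TA \<phi>}))
       \<and> (connected_space T \<longrightarrow>
            (\<forall>(A :: 'a monoid) TA \<phi>. discrete_abelian_G_module G T A TA \<phi> \<longrightarrow>
               H1 G T A TA \<phi> = {H1_basepoint G T A TA \<phi>}))"
proof (intro conjI iffI impI allI)
  assume *: "\<forall>(A :: ('g \<Rightarrow> int) monoid) TA \<phi>. discrete_abelian_G_module G T A TA \<phi> \<longrightarrow>
               H1 G T A TA \<phi> = {H1_basepoint G T A TA \<phi>}"
  interpret topological_group G T by fact
  have opn: "openin T (connected_component_of_set T g)" if "g \<in> carrier G" for g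
    using assms(2) openin_all_components that by blast
  show "connected_space T"
    using connected_if_H1_trivial[OF opn] * discrete_abelian_augmentation_module[OF opn] by blast
\<comment> \<open>Both remaining goals are the implication from connectedness, at the two
  coefficient types.\<close>
qed (rule discrete_abelian_G_module.H1_trivial_if_connected; assumption)+

end
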